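(* Let $K \subset \mathbb{R}^d$ be compact. Suppose that for any $d+1$ points in $K$ there is a unit sphere such that every point in the sphere sees all $d+1$ points. Then there is a unit sphere such that every point in the sphere sees all of $K$.
   Context: For $K \subset \mathbb{R}^d$ and $x,y \in K$, $x$ sees $y$ if the closed segment $[x,y]$ is contained in $K$. Following the paper's usage, a "unit sphere" means a closed ball $B(c,1)=\{y : \|y-c\| \le 1\}$ of radius $1$ in $\mathbb{R}^d$, and "every point in the sphere" means every point of this ball. *)

theory Defs
  imports "HOL-Analysis.Analysis"
begin

definition sees :: "'a::real_vector set \<Rightarrow> 'a \<Rightarrow> 'a \<Rightarrow> bool" where
  "sees K x y \<longleftrightarrow> x \<in> K \<and> y \<in> K \<and> closed_segment x y \<subseteq> K"

end

theory Submission
  imports Defs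
begin

text \<open>Krasnoselskii's argument. The centres \<open>c\<close> of the unit balls contained in the convex hull of the
  set of points seeing \<open>y\<close> form a compact convex set, and by hypothesis any \<open>d + 1\<close> of these sets
  meet, so by Helly's theorem all of them have a common point \<open>c\<close>. Moreover a point \<open>z\<close>
  lying in all the hulls sees all of \<open>K\<close>. Otherwise, following \<open>[z, y]\<close> from a point \<open>u\<close> outside \<open>K\<close>
  almost to where it next meets \<open>K\<close>, one finds a point \<open>q \<noteq> u\<close> and a \<open>k \<in> K\<close> realising the distance
  from that piece to \<open>K\<close>. All points seeing \<open>k\<close> lie in the half-space through \<open>k\<close> facing away
  from \<open>q\<close>, while \<open>z\<close> does not.\<close>

text \<open>Compactness reduces the claim to finite subfamilies. Helly's theorem handles those with
  at least \<open>DIM('a) + 1\<close> members, and \<open>meet\<close> handles the smaller ones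
  directly.\<close>

lemma helly_compact_image:
  fixes C :: "'b \<Rightarrow> 'a::euclidean_space set"
  assumes "\<And>i. i \<in> I \<Longrightarrow> convex (C i)" and "\<And>i. i \<in> I \<Longrightarrow> compact (C i)"
    and meet: "\<And>J. \<lbrakk>J \<subseteq> I; finite J; card J \<le> DIM('a) + 1\<rbrakk> \<Longrightarrow> (\<Inter>i\<in>J. C i) \<noteq> {}"
  shows "(\<Inter>i\<in>I. C i) \<noteq> {}"
proof (rule compact_fip_Heine_Borel)
  show "compact T" if "T \<in> C ` I" for T
    using that assms by auto
  have small: "\<Inter>G \<noteq> {}" if G: "G \<subseteq> C ` I" "finite G" "card G \<le> DIM('a) + 1" for G
  proof -
    \<comment> \<open>One index is picked per set in \<open>G\<close>, so
      \<open>card J = card G\<close> even if \<open>C\<close> repeats values on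
      \<open>I\<close>.\<close>
    obtain J where "J \<subseteq> I" "inj_on C J" "G = C ` J"
      using subset_image_inj G(1) by metis
    then show ?thesis
      using meet[of J] G by (auto simp: card_image finite_image_iff)
  qed
  fix F assume F: "finite F" "F \<subseteq> C ` I"
  show "\<Inter>F \<noteq> {}"
  proof (cases "card F \<le> DIM('a) + 1")
    case True
    then show ?thesis using small F by blast
  next
    case False
    show ?thesis
    proof (rule Helly)
      show "DIM('a) + 1 \<le> card F" using False by simp
      show "\<forall>s\<in>F. convex s" using F assms by auto
      show "\<Inter>t \<noteq> {}" if "t \<subseteq> F" "card t = DIM('a) + 1" for t
        using small[of t] that F finite_subset[of t F] by auto
    qed
  qed
qed

text \<open>Writing the set of admissible centres as an intersection of translates of
  \<open>H\<close> lets it inherit convexity and closedness from \<open>H\<close>.\<close>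

lemma cball_subset_conv_translations:
  "{c. cball c r \<subseteq> H} = (\<Inter>b\<in>cball 0 r. (+) (- b) ` H)" for H :: "'a::real_normed_vector set"
proof -
  have "cball c r \<subseteq> H \<longleftrightarrow> (\<forall>b\<in>cball 0 r. c + b \<in> H)" for c
  proof -
    have "cball c r = (+) c ` cball 0 r" using cball_translation[of c 0 r] by simp
    then show ?thesis by (metis image_subset_iff)
  qed
  moreover have "c \<in> (+) (- b) ` H \<longleftrightarrow> c + b \<in> H" for b c
    by (auto simp: image_iff intro!: bexI[of _ "c + b"])
  ultimately show ?thesis by auto
qed

lemma convex_inner_parallel:
  fixes H :: "'a::real_normed_vector set"
  assumes "convex H"
  shows "convex {c. cball c r \<subseteq> H}"
  unfolding cball_subset_conv_translations
  using assms by (intro convex_INT convex_translation)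

lemma compact_inner_parallel:
  fixes H :: "'a::euclidean_space set"
  assumes "compact H" and "0 \<le> r"
  shows "compact {c. cball c r \<subseteq> H}"
proof -
  have "closed {c. cball c r \<subseteq> H}"
    unfolding cball_subset_conv_translations
    using assms by (intro closed_INT ballI closed_translation compact_imp_closed)
  moreover have "{c. cball c r \<subseteq> H} \<subseteq> H"
    using assms(2) by auto
  ultimately show ?thesis
    using assms(1) by (metis bounded_subset compact_eq_bounded_closed)
qed

text \<open>For each fixed parameter \<open>t\<close>, the condition on \<open>x\<close> is a closed
  preimage of \<open>K\<close>; the intersection over all \<open>t\<close> is closed and lies in
  \<open>K\<close>.\<close>

lemma compact_seeing:
  fixes K :: "'a::euclidean_space set"
  assumes "compact K" and "y \<in> K"
  shows "compact {x. sees K x y}"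
proof -
  have *: "sees K x y \<longleftrightarrow> (\<forall>t\<in>{0..1}. (1 - t) *\<^sub>R x + t *\<^sub>R y \<in> K)" for x
    unfolding sees_def closed_segment_def using assms(2) by force
  have "closed (\<Inter>t\<in>{0..1}. (\<lambda>x. (1 - t) *\<^sub>R x + t *\<^sub>R y) -` K)"
    using compact_imp_closed[OF assms(1)]
    by (intro closed_INT ballI closed_vimage) (auto intro!: continuous_intros)
  moreover have "{x. sees K x y} = (\<Inter>t\<in>{0..1}. (\<lambda>x. (1 - t) *\<^sub>R x + t *\<^sub>R y) -` K)"
    by (auto simp: *)
  moreover have "{x. sees K x y} \<subseteq> K" by (auto simp: sees_def)
  ultimately show ?thesis
    using assms(1) by (metis bounded_subset compact_eq_bounded_closed)
qed

text \<open>If \<open>x\<close> sees \<open>k\<close>, then \<open>k\<close> is the point nearest to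
  \<open>q\<close> on the segment from \<open>x\<close> to \<open>k\<close>, so the angle at
  \<open>k\<close> is not acute. The half-space is convex, hence contains the hull too.\<close>

lemma seeing_subset_halfspace:
  fixes K :: "'a::euclidean_space set"
  assumes "\<And>w. w \<in> K \<Longrightarrow> dist q k \<le> dist q w"
  shows "convex hull {x. sees K x k} \<subseteq> {x. (q - k) \<bullet> (x - k) \<le> 0}"
proof (rule hull_minimal)
  show "{x. sees K x k} \<subseteq> {x. (q - k) \<bullet> (x - k) \<le> 0}"
  proof safe
    fix x assume "sees K x k"
    then have "closed_segment x k \<subseteq> K" by (simp add: sees_def)
    then show "(q - k) \<bullet> (x - k) \<le> 0"
      using assms by (intro any_closest_point_dot[of "closed_segment x k"]) auto
  qed
  have "{x. (q - k) \<bullet> (x - k) \<le> 0} = {x. (q - k) \<bullet> x \<le> (q - k) \<bullet> k}"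
    by (simp add: inner_diff_right)
  then show "convex {x. (q - k) \<bullet> (x - k) \<le> 0}"
    by (simp add: convex_halfspace_le)
qed

lemma sees_if_in_convex_hulls:
  fixes K :: "'a::euclidean_space set"
  assumes "compact K" and z: "\<And>y. y \<in> K \<Longrightarrow> z \<in> convex hull {x. sees K x y}" and "y \<in> K"
  shows "sees K z y"
proof (rule ccontr)
  define f where "f t = z + t *\<^sub>R (y - z)" for t
  have cont: "continuous_on A f" for A unfolding f_def by (intro continuous_intros)
  have f01: "f 0 = z" "f 1 = y" by (simp_all add: f_def)
  have seg: "closed_segment (f a) (f b) = f ` {a..b}" if "a \<le> b" for a b
  proof -
    have "f ((1 - u) *\<^sub>R a + u *\<^sub>R b) = (1 - u) *\<^sub>R f a + u *\<^sub>R f b" for u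
      by (simp add: f_def algebra_simps)
    then have "closed_segment (f a) (f b) = f ` closed_segment a b"
      unfolding closed_segment_def by (force simp: image_iff)
    then show ?thesis using that by (simp add: closed_segment_eq_real_ivl)
  qed
  assume "\<not> sees K z y"
  then have "\<not> closed_segment z y \<subseteq> K"
    using \<open>y \<in> K\<close> by (auto simp: sees_def)
  then have "\<not> f ` {0..1} \<subseteq> K"
    using seg[of 0 1] f01 by simp
  then obtain s where s: "0 \<le> s" "s \<le> 1" "f s \<notin> K"
    by (metis image_subsetI atLeastAtMost_iff)
  \<comment> \<open>The infimum of \<open>S\<close> is the parameter at which the path first
    re-enters \<open>K\<close> after \<open>s\<close>.\<close>
  define S where "S = {s..1} \<inter> f -` K"
  have "closed S"
    unfolding S_def using cont compact_imp_closed[OF assms(1)]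
    by (intro continuous_closed_preimage) auto
  moreover have "1 \<in> S" using s f01 \<open>y \<in> K\<close> by (auto simp: S_def)
  moreover have bdd: "bdd_below S" by (auto simp: S_def intro: bdd_belowI[of _ s])
  ultimately have "Inf S \<in> S" using closed_contains_Inf by blast
  define t0 where "t0 = Inf S"
  have t0: "s < t0" "t0 \<le> 1" "f t0 \<in> K"
    using \<open>Inf S \<in> S\<close> s unfolding t0_def S_def by (auto simp: order.order_iff_strict)
  have below: "f t \<notin> K" if "s \<le> t" "t < t0" for t
    using that t0 cInf_lower[OF _ bdd, of t] unfolding t0_def S_def by force
  have "isCont f t0" unfolding f_def by (intro continuous_intros)
  moreover have u_far: "0 < infdist (f s) K"
    using s compact_imp_closed[OF assms(1)] \<open>y \<in> K\<close>
    by (metis empty_iff in_closed_iff_infdist_zero infdist_nonneg less_eq_real_def)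
  ultimately obtain d where d: "d > 0" "\<And>t. \<bar>t - t0\<bar> < d \<Longrightarrow> dist (f t) (f t0) < infdist (f s) K"
    unfolding continuous_at_eps_delta by (metis dist_real_def)
  \<comment> \<open>Stopping just before \<open>t0\<close> keeps \<open>T\<close> off
    \<open>K\<close>, yet brings its end closer to \<open>K\<close> than \<open>f s\<close> is.
    Hence the minimiser \<open>q\<close> cannot be \<open>f s\<close>.\<close>
  define t1 where "t1 = max s (t0 - d / 2)"
  have t1: "s \<le> t1" "t1 < t0" "dist (f t1) (f t0) < infdist (f s) K"
    using d t0 by (auto simp: t1_def intro!: d(2))
  define T where "T = closed_segment (f s) (f t1)"
  have T: "T = f ` {s..t1}" using seg t1 by (simp add: T_def)
  have "\<exists>q\<in>T. \<exists>k\<in>K. dist q k = setdist T K"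
    using assms(1) \<open>y \<in> K\<close> by (intro setdist_compact_closed compact_imp_closed) (auto simp: T_def)
  then obtain q k where qk: "q \<in> T" "k \<in> K" "dist q k = setdist T K" by blast
  have min: "dist q k \<le> dist a b" if "a \<in> T" "b \<in> K" for a b
    using that qk setdist_le_dist by metis
  obtain r where r: "s \<le> r" "r \<le> t1" "q = f r" using qk(1) T by auto
  have "dist q k \<le> dist (f t1) (f t0)" using min t0 by (simp add: T_def)
  also have "\<dots> < infdist (f s) K" by (rule t1)
  also have "\<dots> \<le> dist (f s) k" using qk(2) by (rule infdist_le)
  finally have "r \<noteq> s" using r by auto
  then have "s < r" using r by simp
  have "q \<noteq> k" using below r t1 qk(2) by auto
  \<comment> \<open>Now \<open>q\<close> is the point of \<open>T\<close> nearest to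
    \<open>k\<close>. As \<open>f s - q\<close> is a positive multiple of \<open>z - y\<close>, the
    inequality carries over to \<open>z\<close>, which may lie outside \<open>T\<close>.\<close>
  have "(k - q) \<bullet> (f s - q) \<le> 0"
    using min[OF _ qk(2)] qk(1)
    by (intro any_closest_point_dot[of T]) (auto simp: T_def dist_commute)
  also have "f s - q = (r - s) *\<^sub>R (z - y)"
    by (simp add: r(3) f_def algebra_simps)
  finally have "(k - q) \<bullet> (z - y) \<le> 0"
    using \<open>s < r\<close> by (simp add: mult_le_0_iff)
  moreover have "z - q = r *\<^sub>R (z - y)" by (simp add: r(3) f_def algebra_simps)
  ultimately have "(q - k) \<bullet> (z - q) \<ge> 0"
    using \<open>s < r\<close> s by (simp add: inner_diff_left mult_left_mono)
  moreover have "(q - k) \<bullet> (q - k) > 0" using \<open>q \<noteq> k\<close> by simp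
  moreover have "(q - k) \<bullet> (z - k) = (q - k) \<bullet> (z - q) + (q - k) \<bullet> (q - k)"
    by (simp add: inner_add_right[symmetric])
  ultimately have "(q - k) \<bullet> (z - k) > 0" by linarith
  moreover have "(q - k) \<bullet> (z - k) \<le> 0"
    using seeing_subset_halfspace[of K q k] min[OF qk(1)] z[OF qk(2)] by auto
  ultimately show False by simp
qed

theorem theorem3p6:
  fixes K :: "(real ^ 'n) set"
  assumes "compact K"
    and "\<And>p :: nat \<Rightarrow> real ^ 'n. (\<And>i. i < CARD('n) + 1 \<Longrightarrow> p i \<in> K) \<Longrightarrow>
           \<exists>c. \<forall>x \<in> cball c 1. \<forall>i < CARD('n) + 1. sees K x (p i)"
  shows "\<exists>c. \<forall>x \<in> cball c 1. \<forall>y \<in> K. sees K x y"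
proof -
  define H where "H y = convex hull {x. sees K x y}" for y
  have "(\<Inter>y\<in>K. {c. cball c 1 \<subseteq> H y}) \<noteq> {}"
  proof (rule helly_compact_image)
    show "convex {c. cball c 1 \<subseteq> H y}" for y
      by (simp add: H_def convex_inner_parallel)
    show "compact {c. cball c 1 \<subseteq> H y}" if "y \<in> K" for y
      using that assms(1) by (simp add: H_def compact_inner_parallel compact_convex_hull compact_seeing)
    fix J assume J: "J \<subseteq> K" "finite J" "card J \<le> DIM(real ^ 'n) + 1"
    show "(\<Inter>y\<in>J. {c. cball c 1 \<subseteq> H y}) \<noteq> {}"
    proof (cases "J = {}")
      case False
      obtain e where e: "bij_betw e {0..<card J} J"
        using ex_bij_betw_nat_finite J(2) by blast
      \<comment> \<open>The hypothesis wants exactly \<open>CARD('n) + 1\<close> points, so a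
        smaller \<open>J\<close> is padded by repeating \<open>e 0\<close>; this is why
        \<open>J\<close> must be nonempty here.\<close>
      define p where "p i = (if i < card J then e i else e 0)" for i
      have "card J > 0" using False J by (simp add: card_gt_0_iff)
      then have "p i \<in> K" for i
        using J(1) bij_betwE[OF e] by (auto simp: p_def)
      then obtain c where c: "\<forall>x \<in> cball c 1. \<forall>i < CARD('n) + 1. sees K x (p i)"
        using assms(2) by blast
      have "sees K x y" if x: "x \<in> cball c 1" and "y \<in> J" for x y
      proof -
        obtain i where i: "i < card J" "e i = y"
          using e \<open>y \<in> J\<close> unfolding bij_betw_def by force
        then have "p i = y" "i < CARD('n) + 1" using J(3) by (auto simp: p_def)
        then show ?thesis using c x by blast
      qed
      then have "cball c 1 \<subseteq> H y" if "y \<in> J" for y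
        using that by (auto simp: H_def intro!: hull_inc)
      then show ?thesis by blast
    qed simp
  qed
  then obtain c where "\<And>y. y \<in> K \<Longrightarrow> cball c 1 \<subseteq> H y" by auto
  then have "\<forall>x \<in> cball c 1. \<forall>y \<in> K. sees K x y"
    unfolding H_def using sees_if_in_convex_hulls[OF assms(1)] by blast
  then show ?thesis ..
qed

end
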